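(* Let $M\colon[-1,0]\to\mathbb{R}$ be a function of bounded variation, continuous from the right on $(-1,0)$, with $M\in\mathcal W$ (that is, $M(0)-M(0^-)\neq 1$), and let $\mu$ be the finite signed Borel measure on $[-1,0]$ associated with $M$. Consider the scalar delay-difference equation $$x(t)=\int_{-1}^0 \mathrm{d}M(\theta)\,x(t+\theta),\qquad t\ge 0. \tag{E}$$ Then the following statements are equivalent. 1) The total variation of $\mu$ in $[-1,0]$ is less than $1$, i.e., $\displaystyle\int_{-1}^0 \mathrm{d}|\mu|(\xi)<1$. 2) Equation (E) is locally strongly stable. 3) Equation (E) is strongly stable.
   Context: Scalar case: all functions and measures are real-valued. Associated measure: for $M\colon[-1,0]\to\mathbb{R}$ of bounded variation and continuous from the right on $(-1,0)$, $\mu$ is the unique finite signed Borel measure on $[-1,0]$ with $\mu([-1,t])=M(t)-M(-1)$ for all $t\in(-1,0]$. Then $\int_{-1}^0 \mathrm{d}M(\theta)\,y(\theta)$ (Riemann--Stieltjes) equals $\int_{[-1,0]} y(\theta)\,\mathrm{d}\mu(\theta)$ for every continuous $y$. $|\mu|$ denotes the total variation measure of $\mu$, and integrals $\int_{-1}^0$ against measures are over the closed interval $[-1,0]$. The class $\mathcal W$: $M\in\mathcal W$ means that $M$ is of bounded variation and $1-(M(0)-M(0^-))\neq0$. A finite signed Borel measure $\nu$ on $[-1,0]$ is said to belong to $\mathcal W$ if its associated function does, i.e. if $\nu(\{0\})\neq 1$. Solutions: for a finite signed Borel measure $\nu$ on $[-1,0]$, a (global) solution of $x(t)=\int_{-1}^0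 \mathrm{d}\nu(\theta)\,x(t+\theta)$ is a continuous function $x\colon[-1,+\infty)\to\mathbb{R}$ satisfying this equality for all $t\ge0$. For $t\ge 0$, $x_t\in C([-1,0];\mathbb{R})$ is defined by $x_t(\theta)=x(t+\theta)$, and $\|\cdot\|_\infty$ is the supremum norm on $[-1,0]$. Exponential stability: the equation is exponentially stable if there are constants $\alpha,K>0$ such that every solution $x$ satisfies $\|x_t\|_\infty\le K e^{-\alpha t}\|x_0\|_\infty$ for all $t\ge0$. Strong stability: let $\mathbf B$ be the set of Borel-measurable functions $\varphi\colon[-1,0]\to[-1,0]$, let $\varphi_*\mu$ be the pushforward of $\mu$ by $\varphi$, i.e. $\varphi_*\mu(S)=\mu(\varphi^{-1}(S))$, let $\mathrm{id}$ be the identity function of $[-1,0]$, and for $\varphi\in\mathbf B$ consider the perturbed equation $$x(t)=\int_{-1}^0 \mathrm{d}(\varphi_*\mu)(\theta)\,x(t+\theta),\qquad t\ge0. \tag{E$_\varphi$}$$ - (E) is locally strongly stable if there exists $\epsilon>0$ such that, for all $\varphi\in\mathbf B$ with $\|\varphi-\mathrm{id}\|_\infty<\epsilon$ and $\varphi_*\mu\in\mathcal W$, equation (E$_\varphi$) is exponentially stable. - (E) is strongly stable if, for all $\varphi\in\mathbf B$ with $\varphi_*\mu\in\mathcal W$, equation (E$_\varphi$) is exponentially stable. *)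

theory Defs
  imports "HOL-Analysis.Analysis"
begin

section \<open>Finite signed measures\<close>

text \<open>
  A finite signed measure on a measurable space \<open>X\<close> (only \<open>space X\<close> and \<open>sets X\<close> matter) is a
  real-valued countably additive set function on \<open>sets X\<close>. Values on non-measurable sets are
  irrelevant.
\<close>

definition signed_measure :: "'a measure \<Rightarrow> ('a set \<Rightarrow> real) \<Rightarrow> bool" where
  "signed_measure X \<nu> \<longleftrightarrow> \<nu> {} = 0 \<and>
     (\<forall>A. range A \<subseteq> sets X \<longrightarrow> disjoint_family A \<longrightarrow>
        (\<lambda>i::nat. \<nu> (A i)) sums \<nu> (\<Union>i. A i))"

definition total_variation :: "'a measure \<Rightarrow> ('a set \<Rightarrow> real) \<Rightarrow> 'a measure" where
  "total_variation X \<nu> = measure_of (space X) (sets X)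
     (\<lambda>S. SUP P \<in> {P. finite P \<and> P \<subseteq> sets X \<and> partition_on S P}. \<Sum>A\<in>P. ennreal \<bar>\<nu> A\<bar>)"

text \<open>
  The positive part of the Jordan decomposition; the negative part is the positive part of the
  opposite measure. Truncation of negative values by \<open>ennreal\<close> is harmless in the supremum, since
  \<open>\<nu> {} = 0\<close> and the empty set is among the subsets considered.
\<close>

definition positive_variation :: "'a measure \<Rightarrow> ('a set \<Rightarrow> real) \<Rightarrow> 'a measure" where
  "positive_variation X \<nu> = measure_of (space X) (sets X)
     (\<lambda>S. SUP A \<in> {A \<in> sets X. A \<subseteq> S}. ennreal (\<nu> A))"

definition signed_integral :: "'a measure \<Rightarrow> ('a set \<Rightarrow> real) \<Rightarrow> ('a \<Rightarrow> real) \<Rightarrow> real" where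
  "signed_integral X \<nu> f =
     (\<integral>\<theta>. f \<theta> \<partial>(positive_variation X \<nu>)) - (\<integral>\<theta>. f \<theta> \<partial>(positive_variation X (\<lambda>A. - \<nu> A)))"

text \<open>
  The set functions passed to \<open>measure_of\<close> above are countably additive, so they are the values of the
  resulting measures (\<open>measure_of\<close> would otherwise return the null measure).
\<close>

lemma countably_additive_of_superadditive:
  fixes f :: "'a set \<Rightarrow> ennreal"
  assumes mono: "\<And>A B. A \<in> sets X \<Longrightarrow> B \<in> sets X \<Longrightarrow> A \<subseteq> B \<Longrightarrow> f A \<le> f B"
    and super: "\<And>A B. A \<in> sets X \<Longrightarrow> B \<in> sets X \<Longrightarrow> A \<inter> B = {} \<Longrightarrow> f A + f B \<le> f (A \<union> B)"
    and sub: "\<And>A. range A \<subseteq> sets X \<Longrightarrow> disjoint_family A \<Longrightarrow> f (\<Union>i::nat. A i) \<le> (\<Sum>i. f (A i))"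
  shows "countably_additive (sets X) f"
proof (rule countably_additiveI)
  fix A :: "nat \<Rightarrow> 'a set"
  assume A: "range A \<subseteq> sets X" "disjoint_family A"
  have partial: "(\<Sum>i<n. f (A i)) \<le> f (\<Union>i<n. A i)" for n
  proof (induction n)
    case (Suc n)
    have "(\<Union>i<n. A i) \<inter> A n = {}"
    proof -
      have "A i \<inter> A n = {}" if "i < n" for i
        using A(2) that by (intro disjoint_family_onD[of A UNIV]) auto
      then show ?thesis by blast
    qed
    moreover have "(\<Union>i<n. A i) \<in> sets X" "A n \<in> sets X" using A(1) by auto
    ultimately have "f (\<Union>i<n. A i) + f (A n) \<le> f ((\<Union>i<n. A i) \<union> A n)"
      by (intro super)
    moreover have "(\<Union>i<n. A i) \<union> A n = (\<Union>i<Suc n. A i)"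
      by (simp add: lessThan_Suc Un_commute)
    moreover have "(\<Sum>i<Suc n. f (A i)) \<le> f (\<Union>i<n. A i) + f (A n)"
      using Suc by (simp add: add_right_mono)
    ultimately show ?case using order_trans by metis
  qed simp
  have "(\<Sum>i. f (A i)) \<le> f (\<Union>i. A i)"
  proof (rule suminf_le_const)
    fix n
    have "f (\<Union>i<n. A i) \<le> f (\<Union>i. A i)"
      using A(1) by (intro mono) auto
    then show "(\<Sum>i<n. f (A i)) \<le> f (\<Union>i. A i)" using partial order_trans by blast
  qed simp
  with sub[OF A] show "(\<Sum>i. f (A i)) = f (\<Union>i. A i)" by simp
qed

lemma ennreal_SUP_add_le:
  fixes f :: "'a \<Rightarrow> ennreal" and g :: "'b \<Rightarrow> ennreal"
  assumes "I \<noteq> {}" "J \<noteq> {}" "\<And>i j. i \<in> I \<Longrightarrow> j \<in> J \<Longrightarrow> f i + g j \<le> c"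
  shows "(SUP i\<in>I. f i) + (SUP j\<in>J. g j) \<le> c"
proof -
  have "f i + (SUP j\<in>J. g j) \<le> c" if "i \<in> I" for i
  proof -
    have "f i + (SUP j\<in>J. g j) = (SUP j\<in>J. f i + g j)"
      by (rule ennreal_SUP_add_right[OF assms(2)])
    also have "\<dots> \<le> c"
      by (rule SUP_least) (rule assms(3)[OF that])
    finally show ?thesis .
  qed
  then have "(SUP i\<in>I. f i + (SUP j\<in>J. g j)) \<le> c"
    by (rule SUP_least)
  moreover have "(SUP i\<in>I. f i + (SUP j\<in>J. g j)) = (SUP i\<in>I. f i) + (SUP j\<in>J. g j)"
    by (rule ennreal_SUP_add_left[OF assms(1)])
  ultimately show ?thesis by simp
qed

lemma ennreal_sums_le:
  assumes "f sums s"
  shows "ennreal s \<le> (\<Sum>i. ennreal (f i))"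
proof (rule LIMSEQ_le_const2)
  show "(\<lambda>n. ennreal (\<Sum>i<n. f i)) \<longlonglongrightarrow> ennreal s"
    using assms by (intro tendsto_ennrealI) (simp add: sums_def)
  have "ennreal (\<Sum>i<n. f i) \<le> (\<Sum>i. ennreal (f i))" for n
  proof -
    have "ennreal (\<Sum>i<n. f i) \<le> ennreal (\<Sum>i<n. max 0 (f i))"
      by (intro ennreal_leI sum_mono) auto
    also have "\<dots> = (\<Sum>i<n. ennreal (max 0 (f i)))"
      by (simp add: sum_ennreal)
    also have "\<dots> = (\<Sum>i<n. ennreal (f i))"
      by (intro sum.cong) (auto simp: max_def ennreal_neg)
    also have "\<dots> \<le> (\<Sum>i. ennreal (f i))"
      by (rule sum_le_suminf) auto
    finally show ?thesis .
  qed
  then show "\<exists>N. \<forall>n\<ge>N. ennreal (\<Sum>i<n. f i) \<le> (\<Sum>i. ennreal (f i))" by blast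
qed

lemma signed_measure_sums_Int:
  assumes "signed_measure X \<nu>" "B \<in> sets X" "range A \<subseteq> sets X" "disjoint_family A"
    and "B \<subseteq> (\<Union>i::nat. A i)"
  shows "(\<lambda>i. \<nu> (B \<inter> A i)) sums \<nu> B"
proof -
  have "range (\<lambda>i. B \<inter> A i) \<subseteq> sets X" using assms(2,3) by auto
  moreover have "disjoint_family (\<lambda>i. B \<inter> A i)"
    using assms(4) by (auto simp: disjoint_family_on_def)
  moreover have "(\<Union>i. B \<inter> A i) = B" using assms(5) by auto
  ultimately have "(\<lambda>i. \<nu> (B \<inter> A i)) sums \<nu> (\<Union>i. B \<inter> A i)"
    using assms(1) unfolding signed_measure_def by blast
  then show ?thesis by (simp only: \<open>(\<Union>i. B \<inter> A i) = B\<close>)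
qed

lemma disjoint_family_binaryset:
  assumes "A \<inter> B = {}"
  shows "disjoint_family (binaryset A B)"
  using assms unfolding disjoint_family_on_def binaryset_def by auto

lemma signed_measure_Un:
  assumes "signed_measure X \<nu>" "A \<in> sets X" "B \<in> sets X" "A \<inter> B = {}"
  shows "\<nu> (A \<union> B) = \<nu> A + \<nu> B"
proof -
  have "range (binaryset A B) \<subseteq> sets X"
    using assms(2,3) by (simp add: range_binaryset_eq)
  moreover have "disjoint_family (binaryset A B)"
    using assms(4) by (rule disjoint_family_binaryset)
  ultimately have "(\<lambda>i. \<nu> (binaryset A B i)) sums \<nu> (\<Union>i. binaryset A B i)"
    using assms(1) unfolding signed_measure_def by blast
  then have "(\<lambda>i. \<nu> (binaryset A B i)) sums \<nu> (A \<union> B)"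
    by (simp only: UN_binaryset_eq)
  moreover have "(\<lambda>i. \<nu> (binaryset A B i)) sums (\<nu> A + \<nu> B)"
    using assms(1) by (intro binaryset_sums) (simp add: signed_measure_def)
  ultimately show ?thesis by (rule sums_unique2)
qed

lemma emeasure_positive_variation:
  assumes \<nu>: "signed_measure X \<nu>" and S: "S \<in> sets X"
  shows "emeasure (positive_variation X \<nu>) S = (SUP A \<in> {A \<in> sets X. A \<subseteq> S}. ennreal (\<nu> A))"
proof -
  define f where "f S = (SUP A \<in> {A \<in> sets X. A \<subseteq> S}. ennreal (\<nu> A))" for S
  have [simp]: "\<nu> {} = 0" using \<nu> by (simp add: signed_measure_def)
  have "f {} = 0" by (auto simp: f_def bot_ennreal intro!: antisym SUP_least)
  then have pos: "positive (sets X) f" by (simp add: positive_def)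
  have ca: "countably_additive (sets X) f"
  proof (rule countably_additive_of_superadditive)
    show "f A \<le> f B" if "A \<subseteq> B" for A B
      using that unfolding f_def by (intro SUP_subset_mono) auto
    show "f A + f B \<le> f (A \<union> B)" if AB: "A \<in> sets X" "B \<in> sets X" "A \<inter> B = {}" for A B
      unfolding f_def
    proof (rule ennreal_SUP_add_le)
      fix a b assume a: "a \<in> {C \<in> sets X. C \<subseteq> A}" and b: "b \<in> {C \<in> sets X. C \<subseteq> B}"
      define a' where "a' = (if \<nu> a < 0 then {} else a)"
      define b' where "b' = (if \<nu> b < 0 then {} else b)"
      have 1: "ennreal (\<nu> a) = ennreal (\<nu> a')" "\<nu> a' \<ge> 0"
              "ennreal (\<nu> b) = ennreal (\<nu> b')" "\<nu> b' \<ge> 0"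
        by (auto simp: a'_def b'_def ennreal_neg)
      have 2: "a' \<in> sets X" "b' \<in> sets X" "a' \<subseteq> A" "b' \<subseteq> B"
        using a b by (auto simp: a'_def b'_def)
      have "\<nu> (a' \<union> b') = \<nu> a' + \<nu> b'"
        using 2 AB by (intro signed_measure_Un[OF \<nu>]) auto
      then have "ennreal (\<nu> a) + ennreal (\<nu> b) = ennreal (\<nu> (a' \<union> b'))"
        using 1 by (simp add: ennreal_plus)
      also have "\<dots> \<le> (SUP C\<in>{C \<in> sets X. C \<subseteq> A \<union> B}. ennreal (\<nu> C))"
        using 2 by (intro SUP_upper) auto
      finally show "ennreal (\<nu> a) + ennreal (\<nu> b) \<le> \<dots>" .
    qed auto
    show "f (\<Union>i. A i) \<le> (\<Sum>i. f (A i))"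
      if A: "range A \<subseteq> sets X" "disjoint_family A" for A :: "nat \<Rightarrow> 'a set"
      unfolding f_def
    proof (rule SUP_least)
      fix B assume B: "B \<in> {B \<in> sets X. B \<subseteq> (\<Union>i. A i)}"
      have "(\<lambda>i. \<nu> (B \<inter> A i)) sums \<nu> B"
        using B by (intro signed_measure_sums_Int[OF \<nu> _ A]) auto
      then have "ennreal (\<nu> B) \<le> (\<Sum>i. ennreal (\<nu> (B \<inter> A i)))"
        by (rule ennreal_sums_le)
      also have "\<dots> \<le> (\<Sum>i. SUP C\<in>{C \<in> sets X. C \<subseteq> A i}. ennreal (\<nu> C))"
        using B A(1) by (intro suminf_le SUP_upper) auto
      finally show "ennreal (\<nu> B) \<le> \<dots>" .
    qed
  qed
  show ?thesis
    using emeasure_measure_of_sigma[OF sets.sigma_algebra_axioms pos ca S]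
    by (simp add: positive_variation_def f_def[abs_def])
qed

lemma emeasure_total_variation:
  assumes \<nu>: "signed_measure X \<nu>" and S: "S \<in> sets X"
  shows "emeasure (total_variation X \<nu>) S =
    (SUP P \<in> {P. finite P \<and> P \<subseteq> sets X \<and> partition_on S P}. \<Sum>A\<in>P. ennreal \<bar>\<nu> A\<bar>)"
proof -
  define I where "I S = {P. finite P \<and> P \<subseteq> sets X \<and> partition_on S P}" for S
  define f where "f S = (SUP P \<in> I S. \<Sum>A\<in>P. ennreal \<bar>\<nu> A\<bar>)" for S
  have [simp]: "\<nu> {} = 0" using \<nu> by (simp add: signed_measure_def)
  have I_ne: "I S \<noteq> {}" if "S \<in> sets X" for S
  proof -
    have "{S} - {{}} \<in> I S" using that by (auto simp: I_def partition_on_def disjoint_def)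
    then show ?thesis by blast
  qed
  have upper: "(\<Sum>i\<in>J. ennreal \<bar>\<nu> (C i)\<bar>) \<le> f S"
    if J: "finite J" "C ` J \<subseteq> sets X" "disjoint_family_on C J" "(\<Union>i\<in>J. C i) = S"
    for J :: "'c set" and C S
  proof -
    define J' where "J' = {i \<in> J. C i \<noteq> {}}"
    have C_Int: "C i \<inter> C j = {}" if "i \<in> J" "j \<in> J" "i \<noteq> j" for i j
      by (rule disjoint_family_onD[OF J(3) that])
    have inj: "inj_on C J'"
    proof (rule inj_onI)
      fix i j assume "i \<in> J'" "j \<in> J'" "C i = C j"
      then show "i = j" using C_Int[of i j] by (auto simp: J'_def)
    qed
    have "(\<Sum>i\<in>J. ennreal \<bar>\<nu> (C i)\<bar>) = (\<Sum>i\<in>J'. ennreal \<bar>\<nu> (C i)\<bar>)"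
      using J(1) by (intro sum.mono_neutral_right) (auto simp: J'_def)
    also have "\<dots> = (\<Sum>A\<in>C ` J'. ennreal \<bar>\<nu> A\<bar>)"
      by (simp add: sum.reindex[OF inj])
    also have "\<dots> \<le> f S"
      unfolding f_def
    proof (rule SUP_upper)
      have "partition_on S (C ` J')"
        unfolding partition_on_def
      proof (intro conjI)
        show "\<Union> (C ` J') = S" using J(4) by (auto simp: J'_def)
        show "disjoint (C ` J')"
        proof (rule disjointI)
          fix a b assume "a \<in> C ` J'" "b \<in> C ` J'" "a \<noteq> b"
          then obtain i j where "i \<in> J" "j \<in> J" "a = C i" "b = C j" "i \<noteq> j"
            by (auto simp: J'_def)
          then show "a \<inter> b = {}" using C_Int by simp
        qed
      qed (auto simp: J'_def)
      then show "C ` J' \<in> I S" using J(1,2) by (auto simp: I_def J'_def)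
    qed
    finally show ?thesis .
  qed
  have super: "f A + f B \<le> f (A \<union> B)"
    if AB: "A \<in> sets X" "B \<in> sets X" "A \<inter> B = {}" for A B
    unfolding f_def[of A] f_def[of B]
  proof (rule ennreal_SUP_add_le)
    fix P Q assume P: "P \<in> I A" and Q: "Q \<in> I B"
    have part: "partition_on A P" "partition_on B Q" using P Q by (simp_all add: I_def)
    have PQ: "P \<inter> Q = {}"
    proof (rule ccontr)
      assume "P \<inter> Q \<noteq> {}"
      then obtain C where "C \<in> P" "C \<in> Q" by blast
      then have "C \<subseteq> A" "C \<subseteq> B" "C \<noteq> {}"
        using part by (auto simp: partition_on_def)
      then show False using AB(3) by blast
    qed
    have "\<Union>(P \<union> Q) = A \<union> B" "{} \<notin> P \<union> Q"
      using part by (auto simp: partition_on_def)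
    moreover have "disjoint (P \<union> Q)"
      using part AB(3) by (intro disjoint_union) (auto simp: partition_on_def)
    ultimately have "partition_on (A \<union> B) (P \<union> Q)"
      by (simp add: partition_on_def)
    then have PQ_I: "P \<union> Q \<in> I (A \<union> B)"
      using P Q by (simp add: I_def)
    have "(\<Sum>A\<in>P. ennreal \<bar>\<nu> A\<bar>) + (\<Sum>A\<in>Q. ennreal \<bar>\<nu> A\<bar>) = (\<Sum>A\<in>P \<union> Q. ennreal \<bar>\<nu> A\<bar>)"
      using P Q PQ by (subst sum.union_disjoint) (auto simp: I_def)
    also have "\<dots> \<le> f (A \<union> B)"
      unfolding f_def by (rule SUP_upper[OF PQ_I])
    finally show "(\<Sum>A\<in>P. ennreal \<bar>\<nu> A\<bar>) + (\<Sum>A\<in>Q. ennreal \<bar>\<nu> A\<bar>) \<le> f (A \<union> B)" .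
  qed (use AB I_ne in auto)
  have "f {} = 0"
    by (auto simp: f_def bot_ennreal I_def partition_on_empty intro!: antisym SUP_least)
  then have pos: "positive (sets X) f" by (simp add: positive_def)
  have ca: "countably_additive (sets X) f"
  proof (rule countably_additive_of_superadditive)
    show "f A \<le> f B" if "A \<in> sets X" "B \<in> sets X" "A \<subseteq> B" for A B
    proof -
      have "f A + f (B - A) \<le> f (A \<union> (B - A))" using that by (intro super) auto
      moreover have "A \<union> (B - A) = B" using that by auto
      moreover have "f A \<le> f A + f (B - A)" by simp
      ultimately show ?thesis by (metis order_trans)
    qed
    show "f (\<Union>i. A i) \<le> (\<Sum>i. f (A i))"
      if A: "range A \<subseteq> sets X" "disjoint_family A" for A :: "nat \<Rightarrow> 'a set"
      unfolding f_def[of "\<Union>i. A i"]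
    proof (rule SUP_least)
      fix P assume P: "P \<in> I (\<Union>i. A i)"
      then have fin: "finite P" and PX: "P \<subseteq> sets X" and part: "partition_on (\<Union>i. A i) P"
        by (auto simp: I_def)
      have "ennreal \<bar>\<nu> B\<bar> \<le> (\<Sum>i. ennreal \<bar>\<nu> (B \<inter> A i)\<bar>)" if B: "B \<in> P" for B
      proof -
        have s: "(\<lambda>i. \<nu> (B \<inter> A i)) sums \<nu> B"
          using B PX part by (intro signed_measure_sums_Int[OF \<nu> _ A]) (auto simp: partition_on_def)
        have "ennreal (\<nu> B) \<le> (\<Sum>i. ennreal (\<nu> (B \<inter> A i)))"
          by (rule ennreal_sums_le[OF s])
        also have "\<dots> \<le> (\<Sum>i. ennreal \<bar>\<nu> (B \<inter> A i)\<bar>)"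
          by (intro suminf_le ennreal_leI) auto
        finally have 1: "ennreal (\<nu> B) \<le> (\<Sum>i. ennreal \<bar>\<nu> (B \<inter> A i)\<bar>)" .
        have "ennreal (- \<nu> B) \<le> (\<Sum>i. ennreal (- \<nu> (B \<inter> A i)))"
          by (rule ennreal_sums_le[OF sums_minus[OF s]])
        also have "\<dots> \<le> (\<Sum>i. ennreal \<bar>\<nu> (B \<inter> A i)\<bar>)"
          by (intro suminf_le ennreal_leI) auto
        finally show ?thesis using 1 by (simp add: abs_if)
      qed
      then have "(\<Sum>B\<in>P. ennreal \<bar>\<nu> B\<bar>) \<le> (\<Sum>B\<in>P. \<Sum>i. ennreal \<bar>\<nu> (B \<inter> A i)\<bar>)"
        by (rule sum_mono)
      also have "\<dots> = (\<Sum>i. \<Sum>B\<in>P. ennreal \<bar>\<nu> (B \<inter> A i)\<bar>)"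
        by (rule suminf_sum[symmetric]) auto
      also have "\<dots> \<le> (\<Sum>i. f (A i))"
      proof (intro suminf_le upper)
        fix i
        show "disjoint_family_on (\<lambda>B. B \<inter> A i) P"
          using part by (auto simp: partition_on_def disjoint_def disjoint_family_on_def)
        show "(\<Union>B\<in>P. B \<inter> A i) = A i"
          using part by (auto simp: partition_on_def)
        show "(\<lambda>B. B \<inter> A i) ` P \<subseteq> sets X" using PX A(1) by auto
      qed (use fin in auto)
      finally show "(\<Sum>B\<in>P. ennreal \<bar>\<nu> B\<bar>) \<le> (\<Sum>i. f (A i))" .
    qed
  qed (use super in auto)
  show ?thesis
    using emeasure_measure_of_sigma[OF sets.sigma_algebra_axioms pos ca S]
    by (simp add: total_variation_def f_def[abs_def] I_def)
qed


section \<open>Functions of bounded variation and their associated measures\<close>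

abbreviation delay_space :: "real measure" where
  "delay_space \<equiv> restrict_space borel {-1..0}"

definition bounded_variation_on :: "real \<Rightarrow> real \<Rightarrow> (real \<Rightarrow> real) \<Rightarrow> bool" where
  "bounded_variation_on a b M \<longleftrightarrow>
     (\<exists>C. \<forall>(n::nat) p. (\<forall>i\<le>n. p i \<in> {a..b}) \<and> mono_on {..n} p \<longrightarrow>
        (\<Sum>i<n. \<bar>M (p (Suc i)) - M (p i)\<bar>) \<le> C)"

text \<open>\<open>Lim (at_left 0) M\<close> is \<open>M(0\<^sup>-)\<close>; the limit exists by bounded variation.\<close>

definition class_W :: "(real \<Rightarrow> real) \<Rightarrow> bool" where
  "class_W M \<longleftrightarrow> bounded_variation_on (-1) 0 M \<and> 1 - (M 0 - Lim (at_left 0) M) \<noteq> 0"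

definition measure_in_W :: "(real set \<Rightarrow> real) \<Rightarrow> bool" where
  "measure_in_W \<nu> \<longleftrightarrow> \<nu> {0} \<noteq> 1"

definition associated_measure :: "(real \<Rightarrow> real) \<Rightarrow> (real set \<Rightarrow> real) \<Rightarrow> bool" where
  "associated_measure M \<mu> \<longleftrightarrow>
     signed_measure delay_space \<mu> \<and> (\<forall>t\<in>{-1<..0}. \<mu> {-1..t} = M t - M (-1))"


section \<open>Delay-difference equations and their stability\<close>

definition is_solution :: "(real set \<Rightarrow> real) \<Rightarrow> (real \<Rightarrow> real) \<Rightarrow> bool" where
  "is_solution \<nu> x \<longleftrightarrow> continuous_on {-1..} x \<and>
     (\<forall>t\<ge>0. x t = signed_integral delay_space \<nu> (\<lambda>\<theta>. x (t + \<theta>)))"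

definition sup_norm :: "(real \<Rightarrow> real) \<Rightarrow> real" where
  "sup_norm y = (SUP \<theta>\<in>{-1..0}. \<bar>y \<theta>\<bar>)"

definition exponentially_stable :: "(real set \<Rightarrow> real) \<Rightarrow> bool" where
  "exponentially_stable \<nu> \<longleftrightarrow>
     (\<exists>\<alpha>>0. \<exists>K>0. \<forall>x. is_solution \<nu> x \<longrightarrow>
        (\<forall>t\<ge>0. sup_norm (\<lambda>\<theta>. x (t + \<theta>)) \<le> K * exp (- \<alpha> * t) * sup_norm x))"

definition delay_perturbations :: "(real \<Rightarrow> real) set" where
  "delay_perturbations = delay_space \<rightarrow>\<^sub>M delay_space"

definition pushforward :: "(real \<Rightarrow> real) \<Rightarrow> (real set \<Rightarrow> real) \<Rightarrow> real set \<Rightarrow> real" where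
  "pushforward \<phi> \<mu> S = \<mu> (\<phi> -` S \<inter> {-1..0})"

definition locally_strongly_stable :: "(real set \<Rightarrow> real) \<Rightarrow> bool" where
  "locally_strongly_stable \<mu> \<longleftrightarrow>
     (\<exists>\<epsilon>>0. \<forall>\<phi>\<in>delay_perturbations.
        sup_norm (\<lambda>\<theta>. \<phi> \<theta> - \<theta>) < \<epsilon> \<longrightarrow> measure_in_W (pushforward \<phi> \<mu>) \<longrightarrow>
        exponentially_stable (pushforward \<phi> \<mu>))"

definition strongly_stable :: "(real set \<Rightarrow> real) \<Rightarrow> bool" where
  "strongly_stable \<mu> \<longleftrightarrow>
     (\<forall>\<phi>\<in>delay_perturbations. measure_in_W (pushforward \<phi> \<mu>) \<longrightarrow>
        exponentially_stable (pushforward \<phi> \<mu>))"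

end

theory Submission
  imports Defs
begin

text \<open>
  If \<open>c < 1\<close> is the total variation of \<open>\<mu>\<close>, push-forwards have total variation at most \<open>c\<close>, and for
  \<open>c exp(\<alpha>) < 1\<close> the function \<open>exp(\<alpha>t) |x(t)|\<close> of a solution \<open>x\<close> cannot attain a nonzero maximum over
  \<open>[-1, T]\<close> at a point \<open>t \<ge> 0\<close>, so \<open>x\<close> decays exponentially.

  If the total variation is at least \<open>1\<close>, there is a Borel set \<open>Y\<close> with \<open>\<mu>(Y) - \<mu>([-1,0] - Y) \<ge> 1\<close> (in the
  borderline case this needs a Hahn decomposition). Let \<open>\<phi>\<close> move each \<open>\<theta>\<close> to a nearby point \<open>-m/(2n)\<close>,
  \<open>1 \<le> m \<le> 2n\<close>, with \<open>m\<close> even exactly when \<open>\<theta> \<in> Y\<close>. If \<open>b\<^sub>m\<close> are the masses of the atoms of \<open>\<phi>\<^sub>*\<mu>\<close>,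
  then \<open>\<Sum> (-1)\<^sup>m b\<^sub>m exp(-\<sigma>m/(2n))\<close> is at least \<open>1\<close> at \<open>\<sigma> = 0\<close> and tends to \<open>0\<close> as \<open>\<sigma> \<rightarrow> \<infinity>\<close>. At a
  \<open>\<sigma> \<ge> 0\<close> where it equals \<open>1\<close>, \<open>exp(\<sigma>t) cos(2\<pi>nt)\<close> is a solution of the perturbed equation that does not decay.
  As \<open>\<phi>\<close> avoids \<open>0\<close>, \<open>\<phi>\<^sub>*\<mu>\<close> has no mass there and belongs to the class \<open>W\<close>.
\<close>

section \<open>Variation measures and finite additivity of signed measures\<close>

lemma space_positive_variation [simp]: "space (positive_variation X \<nu>) = space X"
  by (simp add: positive_variation_def space_measure_of sets.space_closed)

lemma space_total_variation [simp]: "space (total_variation X \<nu>) = space X"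
  by (simp add: total_variation_def space_measure_of sets.space_closed)

lemma sets_positive_variation [simp]: "sets (positive_variation X \<nu>) = sets X"
  by (simp add: positive_variation_def sets_measure_of sets.space_closed sets.sigma_sets_eq)

lemma borel_measurable_positive_variation [simp]:
  "borel_measurable (positive_variation X \<nu>) = borel_measurable X"
  by (rule measurable_cong_sets) simp_all

lemma signed_measure_empty: "signed_measure X \<nu> \<Longrightarrow> \<nu> {} = 0"
  by (simp add: signed_measure_def)

lemma signed_measure_Diff:
  assumes "signed_measure X \<nu>" "A \<in> sets X" "B \<in> sets X" "B \<subseteq> A"
  shows "\<nu> (A - B) = \<nu> A - \<nu> B"
proof -
  have "\<nu> (B \<union> (A - B)) = \<nu> B + \<nu> (A - B)"
    using assms by (intro signed_measure_Un) auto
  moreover have "B \<union> (A - B) = A" using assms(4) by blast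
  ultimately show ?thesis by simp
qed

lemma signed_measure_finite_UN:
  assumes "signed_measure X \<nu>" "finite I" "\<And>i. i \<in> I \<Longrightarrow> A i \<in> sets X" "disjoint_family_on A I"
  shows "\<nu> (\<Union>i\<in>I. A i) = (\<Sum>i\<in>I. \<nu> (A i))"
  using assms(2-4)
proof (induction I rule: finite_induct)
  case empty
  then show ?case using signed_measure_empty[OF assms(1)] by simp
next
  case (insert i I)
  have "A i \<inter> (\<Union>j\<in>I. A j) = {}"
    using insert.prems(2) insert.hyps(2) by (auto simp: disjoint_family_on_def)
  then have "\<nu> (A i \<union> (\<Union>j\<in>I. A j)) = \<nu> (A i) + \<nu> (\<Union>j\<in>I. A j)"
    using insert.prems insert.hyps by (intro signed_measure_Un[OF assms(1)]) auto
  moreover have "\<nu> (\<Union>j\<in>I. A j) = (\<Sum>j\<in>I. \<nu> (A j))"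
    using insert.prems by (intro insert.IH) (auto simp: disjoint_family_on_def)
  ultimately show ?case using insert.hyps by simp
qed

lemma signed_measure_uminus:
  "signed_measure X \<nu> \<Longrightarrow> signed_measure X (\<lambda>A. - \<nu> A)"
  by (auto simp: signed_measure_def intro!: sums_minus)

lemma signed_measure_pushforward:
  assumes "signed_measure delay_space \<mu>" "\<phi> \<in> delay_perturbations"
  shows "signed_measure delay_space (pushforward \<phi> \<mu>)"
  unfolding signed_measure_def
proof (intro conjI allI impI)
  show "pushforward \<phi> \<mu> {} = 0"
    using signed_measure_empty[OF assms(1)] by (simp add: pushforward_def)
  fix A :: "nat \<Rightarrow> real set"
  assume A: "range A \<subseteq> sets delay_space" "disjoint_family A"
  let ?B = "\<lambda>i. \<phi> -` A i \<inter> {-1..0}"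
  have "?B i \<in> sets delay_space" for i
    using measurable_sets[of \<phi> delay_space delay_space "A i"] assms(2) A(1)
    by (simp add: delay_perturbations_def space_restrict_space image_subset_iff)
  then have "range ?B \<subseteq> sets delay_space" by blast
  moreover have "disjoint_family ?B"
    using A(2) by (auto simp: disjoint_family_on_def)
  ultimately have "(\<lambda>i. \<mu> (?B i)) sums \<mu> (\<Union>i. ?B i)"
    using assms(1) unfolding signed_measure_def by blast
  moreover have "(\<Union>i. ?B i) = \<phi> -` (\<Union>i. A i) \<inter> {-1..0}" by blast
  ultimately show "(\<lambda>i. pushforward \<phi> \<mu> (A i)) sums pushforward \<phi> \<mu> (\<Union>i. A i)"
    by (simp add: pushforward_def)
qed

section \<open>Total variation, sign splittings and the Jordan decomposition\<close>

text \<open>The part \<open>A \<inter> B\<close> cancels in \<open>\<nu> A - \<nu> B\<close>, which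
  leaves two disjoint cells of a partition. Bounds on such differences pass to push-forwards at
  once, because the preimages of \<open>A\<close> and \<open>B\<close> are again two measurable
  sets.\<close>

lemma diff_le_total_variation:
  assumes \<nu>: "signed_measure X \<nu>" and "A \<in> sets X" "B \<in> sets X"
  shows "ennreal (\<nu> A - \<nu> B) \<le> emeasure (total_variation X \<nu>) (space X)"
proof -
  \<comment> \<open>\<open>partition_on\<close> admits no empty cell, hence the removal of
    \<open>{}\<close>.\<close>
  define P where "P = {A - B, B - A, space X - ((A - B) \<union> (B - A))} - {{}}"
  have AX: "A \<subseteq> space X" "B \<subseteq> space X" using assms sets.sets_into_space by auto
  have "\<nu> (A - B) = \<nu> A - \<nu> (A \<inter> B)" "\<nu> (B - A) = \<nu> B - \<nu> (A \<inter> B)"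
    using signed_measure_Diff[OF \<nu>, of A "A \<inter> B"] signed_measure_Diff[OF \<nu>, of B "A \<inter> B"] assms
    by (simp_all add: Diff_Int)
  then have "ennreal (\<nu> A - \<nu> B) \<le> ennreal (\<bar>\<nu> (A - B)\<bar> + \<bar>\<nu> (B - A)\<bar>)"
    by (intro ennreal_leI) auto
  also have "\<dots> = ennreal \<bar>\<nu> (A - B)\<bar> + ennreal \<bar>\<nu> (B - A)\<bar>"
    by (rule ennreal_plus) auto
  also have "\<dots> = (\<Sum>C\<in>{A - B, B - A} - {{}}. ennreal \<bar>\<nu> C\<bar>)"
  \<comment> \<open>The two cells form a set with a single element if they coincide, and this
    happens only if both are empty.\<close>
  proof (cases "A - B = B - A")
    case True
    then have "A = B" by blast
    then show ?thesis by (simp add: signed_measure_empty[OF \<nu>])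
  next
    case False
    have "(\<Sum>C\<in>{A - B, B - A} - {{}}. ennreal \<bar>\<nu> C\<bar>) = (\<Sum>C\<in>{A - B, B - A}. ennreal \<bar>\<nu> C\<bar>)"
      by (rule sum.mono_neutral_left) (auto simp: signed_measure_empty[OF \<nu>])
    then show ?thesis using False by simp
  qed
  also have "\<dots> \<le> (\<Sum>C\<in>P. ennreal \<bar>\<nu> C\<bar>)"
    by (rule sum_mono2) (auto simp: P_def)
  also have "\<dots> \<le> emeasure (total_variation X \<nu>) (space X)"
    unfolding emeasure_total_variation[OF \<nu> sets.top]
  proof (rule SUP_upper, safe)
    show "finite P" by (simp add: P_def)
    show "partition_on (space X) P"
      unfolding partition_on_def
    proof (intro conjI)
      have "pairwise disjnt {A - B, B - A, space X - ((A - B) \<union> (B - A))}"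
        by (simp add: pairwise_insert disjnt_def) blast
      then show "disjoint P"
        unfolding P_def by (rule pairwise_subset) blast
      have Un_nonempty: "\<Union>(S - {{}}) = \<Union>S" for S :: "'a set set" by auto
      show "\<Union>P = space X" unfolding P_def Un_nonempty using AX by auto
    qed (simp add: P_def)
  qed (use assms in \<open>auto simp: P_def\<close>)
  finally show ?thesis .
qed

text \<open>Take a finite partition whose sum exceeds \<open>c\<close> and let \<open>Y\<close> be
  the union of its cells of nonnegative measure. By finite additivity the difference for this
  \<open>Y\<close> is exactly the sum over the partition.\<close>

lemma total_variation_approx:
  assumes \<nu>: "signed_measure X \<nu>" and c: "c < emeasure (total_variation X \<nu>) (space X)"
  obtains Y where "Y \<in> sets X" "c < ennreal (\<nu> Y - \<nu> (space X - Y))"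
proof -
  obtain P where P: "finite P" "P \<subseteq> sets X" "partition_on (space X) P"
    and cP: "c < (\<Sum>A\<in>P. ennreal \<bar>\<nu> A\<bar>)"
    using c unfolding emeasure_total_variation[OF \<nu> sets.top] less_SUP_iff by auto
  define Q where "Q = {A \<in> P. \<nu> A \<ge> 0}"
  have disj: "disjoint_family_on (\<lambda>A. A) R" if "R \<subseteq> P" for R
    using P(3) that unfolding partition_on_def disjoint_def disjoint_family_on_def by blast
  have Un: "\<nu> (\<Union>R) = (\<Sum>A\<in>R. \<nu> A)" if "R \<subseteq> P" for R
    using signed_measure_finite_UN[OF \<nu>, of R "\<lambda>A. A"] disj[OF that] that P finite_subset by auto
  have "space X - \<Union>Q = \<Union>(P - Q)"
    using diff_Union_pairwise_disjoint[of P Q] P(3) by (simp add: partition_on_def Q_def)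
  then have "\<nu> (\<Union>Q) - \<nu> (space X - \<Union>Q) = (\<Sum>A\<in>Q. \<nu> A) - (\<Sum>A\<in>P - Q. \<nu> A)"
    using Un[of Q] Un[of "P - Q"] by (simp add: Q_def)
  also have "\<dots> = (\<Sum>A\<in>P - Q. \<bar>\<nu> A\<bar>) + (\<Sum>A\<in>Q. \<bar>\<nu> A\<bar>)"
  proof -
    have "(\<Sum>A\<in>P - Q. \<bar>\<nu> A\<bar>) = (\<Sum>A\<in>P - Q. - \<nu> A)" "(\<Sum>A\<in>Q. \<bar>\<nu> A\<bar>) = (\<Sum>A\<in>Q. \<nu> A)"
      by (intro sum.cong; auto simp: Q_def)+
    then show ?thesis by (simp add: sum_negf)
  qed
  also have "\<dots> = (\<Sum>A\<in>P. \<bar>\<nu> A\<bar>)"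
    using P(1) by (intro sum.subset_diff[symmetric]) (simp_all add: Q_def)
  finally have "ennreal (\<nu> (\<Union>Q) - \<nu> (space X - \<Union>Q)) = (\<Sum>A\<in>P. ennreal \<bar>\<nu> A\<bar>)"
    by (simp add: sum_ennreal)
  moreover have "\<Union>Q \<in> sets X"
    using P(1,2) by (intro sets.finite_Union) (auto simp: Q_def)
  ultimately show ?thesis using cP that by simp
qed

text \<open>For \<open>A \<subseteq> S\<close> one has
  \<open>\<nu> A = \<nu> S - \<nu> (S - A)\<close>, and \<open>- \<nu> (S - A)\<close> is at most
  the negative variation of \<open>S\<close>.\<close>

lemma positive_variation_diff:
  assumes \<nu>: "signed_measure X \<nu>" and S: "S \<in> sets X"
    and fin: "emeasure (positive_variation X (\<lambda>A. - \<nu> A)) S \<noteq> \<infinity>"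
  shows "emeasure (positive_variation X \<nu>) S \<le>
    ennreal (\<nu> S + measure (positive_variation X (\<lambda>A. - \<nu> A)) S)"
  unfolding emeasure_positive_variation[OF \<nu> S]
proof (rule SUP_least)
  fix A assume A: "A \<in> {A \<in> sets X. A \<subseteq> S}"
  have "ennreal (- \<nu> (S - A)) \<le> emeasure (positive_variation X (\<lambda>A. - \<nu> A)) S"
    unfolding emeasure_positive_variation[OF signed_measure_uminus[OF \<nu>] S]
    using A S by (intro SUP_upper) auto
  also have "\<dots> = ennreal (measure (positive_variation X (\<lambda>A. - \<nu> A)) S)"
    using fin by (intro emeasure_eq_ennreal_measure) auto
  finally have "- \<nu> (S - A) \<le> measure (positive_variation X (\<lambda>A. - \<nu> A)) S"
    by (simp add: ennreal_le_iff)
  then show "ennreal (\<nu> A) \<le> ennreal (\<nu> S + measure (positive_variation X (\<lambda>A. - \<nu> A)) S)"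
    using signed_measure_Diff[OF \<nu> S, of A] A by (intro ennreal_leI) auto
qed

text \<open>Jordan decomposition: the previous lemma is applied to \<open>\<nu>\<close> and to its
  opposite.\<close>

lemma measure_positive_variation_diff:
  assumes \<nu>: "signed_measure X \<nu>" and S: "S \<in> sets X"
    and fin: "emeasure (positive_variation X \<nu>) S \<noteq> \<infinity>"
      "emeasure (positive_variation X (\<lambda>A. - \<nu> A)) S \<noteq> \<infinity>"
  shows "\<nu> S = measure (positive_variation X \<nu>) S - measure (positive_variation X (\<lambda>A. - \<nu> A)) S"
proof -
  let ?p = "positive_variation X \<nu>" and ?n = "positive_variation X (\<lambda>A. - \<nu> A)"
  have "ennreal (\<nu> S) \<le> emeasure ?p S" "ennreal (- \<nu> S) \<le> emeasure ?n S"
    unfolding emeasure_positive_variation[OF \<nu> S]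
      emeasure_positive_variation[OF signed_measure_uminus[OF \<nu>] S]
    using S by (auto intro!: SUP_upper)
  then have lower: "\<nu> S \<le> measure ?p S" "- \<nu> S \<le> measure ?n S"
    using fin by (simp_all add: emeasure_eq_ennreal_measure ennreal_le_iff)
  \<comment> \<open>The bounds in \<open>lower\<close> make the arguments of \<open>ennreal\<close>
    nonnegative, so the inequalities can be read in the reals.\<close>
  have "measure ?p S \<le> \<nu> S + measure ?n S"
    using positive_variation_diff[OF \<nu> S fin(2)] fin(1) lower
    by (simp add: emeasure_eq_ennreal_measure ennreal_le_iff)
  moreover have "measure ?n S \<le> - \<nu> S + measure ?p S"
    using positive_variation_diff[OF signed_measure_uminus[OF \<nu>] S] fin lower
    by (simp add: emeasure_eq_ennreal_measure ennreal_le_iff)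
  ultimately show ?thesis by simp
qed

text \<open>Approximation only reaches values strictly below the total variation. It suffices if
  that exceeds 1; if it equals 1, the supremum has to be attained, and a Hahn set attains
  it.\<close>

lemma total_variation_ge_oneE:
  assumes \<nu>: "signed_measure X \<nu>" and ge: "1 \<le> emeasure (total_variation X \<nu>) (space X)"
  obtains Y where "Y \<in> sets X" "1 \<le> \<nu> Y - \<nu> (space X - Y)"
proof (cases "1 < emeasure (total_variation X \<nu>) (space X)")
  case True
  then obtain Y where "Y \<in> sets X" "ennreal 1 < ennreal (\<nu> Y - \<nu> (space X - Y))"
    using total_variation_approx[OF \<nu>, of 1] by auto
  then show ?thesis using that by (simp add: ennreal_less_iff)
next
  case False
  let ?p = "positive_variation X \<nu>" and ?n = "positive_variation X (\<lambda>A. - \<nu> A)"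
  have tv: "emeasure (total_variation X \<nu>) (space X) = 1"
    using False ge by simp
  \<comment> \<open>A total variation of 1 bounds both Jordan parts, so they are finite measures, as
    the Hahn decomposition requires.\<close>
  have "ennreal (\<nu> A) \<le> 1" "ennreal (- \<nu> A) \<le> 1" if "A \<in> sets X" for A
    using diff_le_total_variation[OF \<nu> that, of "{}"] diff_le_total_variation[OF \<nu> _ that, of "{}"]
    by (simp_all add: tv signed_measure_empty[OF \<nu>])
  then have "emeasure ?p (space X) \<le> 1" "emeasure ?n (space X) \<le> 1"
    unfolding emeasure_positive_variation[OF \<nu> sets.top]
      emeasure_positive_variation[OF signed_measure_uminus[OF \<nu>] sets.top]
    by (auto intro!: SUP_least)
  then have "finite_measure ?p" "finite_measure ?n"
    by (auto intro!: finite_measureI simp: top_unique)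
  then interpret p: finite_measure ?p + n: finite_measure ?n .
  have diff: "\<nu> S = measure ?p S - measure ?n S" if "S \<in> sets X" for S
    using that by (intro measure_positive_variation_diff[OF \<nu>]) auto
  obtain Y where Y: "Y \<in> sets X"
    and pos: "\<And>A. A \<in> sets X \<Longrightarrow> A \<subseteq> Y \<Longrightarrow> emeasure ?n A \<le> emeasure ?p A"
    and neg: "\<And>A. A \<in> sets X \<Longrightarrow> A \<inter> Y = {} \<Longrightarrow> emeasure ?p A \<le> emeasure ?n A"
    using finite_unsigned_Hahn_decomposition[of ?p ?n] p.finite_measure_axioms n.finite_measure_axioms
    by auto
  \<comment> \<open>Passing from \<open>A\<close> to \<open>Y\<close> drops \<open>A - Y\<close>, of
    measure at most 0, and adds \<open>Y - A\<close>, of measure at least 0.\<close>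
  have max: "\<nu> A \<le> \<nu> Y" if A: "A \<in> sets X" for A
  proof -
    have "0 \<le> \<nu> (Y - A)" "\<nu> (A - Y) \<le> 0"
      using pos[of "Y - A"] neg[of "A - Y"] A Y
      by (auto simp: diff p.emeasure_eq_measure n.emeasure_eq_measure)
    moreover have "\<nu> (A - Y) = \<nu> A - \<nu> (A \<inter> Y)" "\<nu> (Y - A) = \<nu> Y - \<nu> (A \<inter> Y)"
      using signed_measure_Diff[OF \<nu>, of A "A \<inter> Y"] signed_measure_Diff[OF \<nu>, of Y "A \<inter> Y"] A Y
      by (simp_all add: Diff_Int)
    ultimately show ?thesis by simp
  qed
  \<comment> \<open>As \<open>\<nu> A - \<nu> (space X - A) = 2 * \<nu> A - \<nu> (space X)\<close>,
    the set \<open>Y\<close> also maximizes this difference, and no \<open>A\<close> can do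
    better.\<close>
  have "1 \<le> \<nu> Y - \<nu> (space X - Y)"
  proof (rule ccontr)
    assume "\<not> ?thesis"
    then have "ennreal (\<nu> Y - \<nu> (space X - Y)) < emeasure (total_variation X \<nu>) (space X)"
      unfolding tv ennreal_1[symmetric] by (intro ennreal_lessI) auto
    then obtain A where A: "A \<in> sets X"
      and "ennreal (\<nu> Y - \<nu> (space X - Y)) < ennreal (\<nu> A - \<nu> (space X - A))"
      by (rule total_variation_approx[OF \<nu>])
    then have "\<nu> Y - \<nu> (space X - Y) < \<nu> A - \<nu> (space X - A)"
      by (meson ennreal_leI not_le)
    then show False
      using max[OF A] signed_measure_Diff[OF \<nu> sets.top A] signed_measure_Diff[OF \<nu> sets.top Y]
        sets.sets_into_space[OF A] sets.sets_into_space[OF Y] by simp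
  qed
  with Y show ?thesis by (rule that)
qed

section \<open>Estimates and finite sums for signed integrals\<close>

text \<open>The two masses are suprema over independent sets \<open>A\<close> and \<open>B\<close>,
  so a bound on all differences controls their sum.\<close>

lemma positive_variation_add_le:
  assumes \<nu>: "signed_measure X \<nu>"
    and le: "\<And>A B. A \<in> sets X \<Longrightarrow> B \<in> sets X \<Longrightarrow> ennreal (\<nu> A - \<nu> B) \<le> c"
  shows "emeasure (positive_variation X \<nu>) (space X) +
    emeasure (positive_variation X (\<lambda>A. - \<nu> A)) (space X) \<le> c"
  unfolding emeasure_positive_variation[OF \<nu> sets.top]
    emeasure_positive_variation[OF signed_measure_uminus[OF \<nu>] sets.top]
proof (rule ennreal_SUP_add_le)
  fix A B assume AB: "A \<in> {A \<in> sets X. A \<subseteq> space X}" "B \<in> {A \<in> sets X. A \<subseteq> space X}"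
  \<comment> \<open>A set of the wrong sign contributes 0 after truncation, like the empty set.
    Replacing it makes both arguments nonnegative, and \<open>ennreal\<close> is additive on
    those.\<close>
  define A' where "A' = (if \<nu> A < 0 then {} else A)"
  define B' where "B' = (if \<nu> B > 0 then {} else B)"
  have "ennreal (\<nu> A) + ennreal (- \<nu> B) = ennreal (\<nu> A') + ennreal (- \<nu> B')"
    by (auto simp: A'_def B'_def signed_measure_empty[OF \<nu>] ennreal_neg)
  also have "\<dots> = ennreal (\<nu> A' - \<nu> B')"
    by (subst ennreal_plus[symmetric]) (auto simp: A'_def B'_def signed_measure_empty[OF \<nu>])
  also have "\<dots> \<le> c"
    using AB by (intro le) (auto simp: A'_def B'_def)
  finally show "ennreal (\<nu> A) + ennreal (- \<nu> B) \<le> c" .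
qed auto

lemma abs_integral_le_measure:
  fixes f :: "'a \<Rightarrow> real"
  assumes "emeasure N (space N) \<noteq> \<infinity>" "\<And>x. x \<in> space N \<Longrightarrow> \<bar>f x\<bar> \<le> B" "0 \<le> B"
  shows "\<bar>\<integral>x. f x \<partial>N\<bar> \<le> B * measure N (space N)"
proof (cases "integrable N f")
  case True
  interpret finite_measure N using assms(1) by (rule finite_measureI)
  have "\<bar>\<integral>x. f x \<partial>N\<bar> \<le> (\<integral>x. \<bar>f x\<bar> \<partial>N)" by (rule integral_abs_bound)
  also have "\<dots> \<le> (\<integral>x. B \<partial>N)"
    using True assms(2) by (intro integral_mono) auto
  finally show ?thesis by (simp add: mult.commute)
\<comment> \<open>A non-integrable \<open>f\<close> has integral 0 by default, which satisfies the
  bound.\<close>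
qed (use assms in \<open>simp add: not_integrable_integral_eq\<close>)

lemma abs_signed_integral_le:
  assumes \<nu>: "signed_measure X \<nu>" and "0 \<le> c" "0 \<le> B"
    and le: "\<And>A B. A \<in> sets X \<Longrightarrow> B \<in> sets X \<Longrightarrow> ennreal (\<nu> A - \<nu> B) \<le> ennreal c"
    and f: "\<And>x. x \<in> space X \<Longrightarrow> \<bar>f x\<bar> \<le> B"
  shows "\<bar>signed_integral X \<nu> f\<bar> \<le> c * B"
proof -
  let ?p = "positive_variation X \<nu>" and ?n = "positive_variation X (\<lambda>A. - \<nu> A)"
  have sum: "emeasure ?p (space X) + emeasure ?n (space X) \<le> ennreal c"
    by (rule positive_variation_add_le[OF \<nu> le])
  then have fin: "emeasure ?p (space X) \<noteq> \<infinity>" "emeasure ?n (space X) \<noteq> \<infinity>"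
    by (auto simp: top_unique)
  then have "measure ?p (space X) + measure ?n (space X) \<le> c"
    using sum \<open>0 \<le> c\<close> by (simp add: emeasure_eq_ennreal_measure flip: ennreal_plus)
  then have "B * measure ?p (space X) + B * measure ?n (space X) \<le> B * c"
    using \<open>0 \<le> B\<close> by (metis distrib_left mult_left_mono)
  moreover have "\<bar>\<integral>x. f x \<partial>?p\<bar> \<le> B * measure ?p (space X)"
    using abs_integral_le_measure[of ?p f B] fin f \<open>0 \<le> B\<close> by simp
  moreover have "\<bar>\<integral>x. f x \<partial>?n\<bar> \<le> B * measure ?n (space X)"
    using abs_integral_le_measure[of ?n f B] fin f \<open>0 \<le> B\<close> by simp
  ultimately show ?thesis
    unfolding signed_integral_def by (simp add: mult.commute)
qed

text \<open>The complement of \<open>G\<close> has only subsets of measure 0, and \<open>{g}\<close>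
  has only the subsets \<open>{}\<close> and \<open>{g}\<close>. So the positive variation lives on
  \<open>G\<close> with mass \<open>max 0 (\<nu> {g})\<close> at \<open>g\<close>, and
  \<open>f\<close> is almost everywhere a combination of indicators.\<close>

lemma integral_positive_variation_finite_support:
  fixes f :: "'a \<Rightarrow> real"
  assumes \<nu>: "signed_measure X \<nu>" and G: "finite G" "\<And>g. g \<in> G \<Longrightarrow> {g} \<in> sets X"
    and null: "\<And>A. A \<in> sets X \<Longrightarrow> A \<inter> G = {} \<Longrightarrow> \<nu> A = 0"
    and f: "f \<in> borel_measurable X"
  shows "(\<integral>x. f x \<partial>(positive_variation X \<nu>)) = (\<Sum>g\<in>G. max 0 (\<nu> {g}) * f g)"
proof -
  let ?p = "positive_variation X \<nu>"
  have atom: "emeasure ?p {g} = ennreal (\<nu> {g})" if "g \<in> G" for g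
    unfolding emeasure_positive_variation[OF \<nu> G(2)[OF that]]
  proof (rule antisym[OF SUP_least SUP_upper])
    fix A assume "A \<in> {A \<in> sets X. A \<subseteq> {g}}"
    then have "A = {} \<or> A = {g}" by auto
    then show "ennreal (\<nu> A) \<le> ennreal (\<nu> {g})"
      by (auto simp: signed_measure_empty[OF \<nu>])
  qed (use G that in auto)
  have GX: "G \<in> sets X"
    using sets.finite_UN[of G "\<lambda>g. {g}" X] G by simp
  have "emeasure ?p (space X - G) = 0"
    unfolding emeasure_positive_variation[OF \<nu> sets.compl_sets[OF GX]]
  proof (rule antisym[OF SUP_least])
    fix A assume "A \<in> {A \<in> sets X. A \<subseteq> space X - G}"
    then have "A \<in> sets X" "A \<inter> G = {}" by blast+
    then show "ennreal (\<nu> A) \<le> 0" by (simp add: null)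
  qed simp
  then have "AE x in ?p. x \<in> G"
    using GX by (intro AE_I[of _ _ "space X - G"]) auto
  then have ae: "AE x in ?p. f x = (\<Sum>g\<in>G. indicator {g} x *\<^sub>R f g)"
  proof eventually_elim
    case (elim x)
    have "(\<Sum>g\<in>G. indicator {g} x *\<^sub>R f g) = (\<Sum>g\<in>G. if g = x then f g else 0)"
      by (intro sum.cong) (auto simp: indicator_def)
    then show ?case using elim G(1) by simp
  qed
  have ind: "(\<lambda>x. indicator {g} x :: real) \<in> borel_measurable X" if "g \<in> G" for g
    using G(2)[OF that] by simp
  have "(\<integral>x. f x \<partial>?p) = (\<integral>x. (\<Sum>g\<in>G. indicator {g} x *\<^sub>R f g) \<partial>?p)"
    using f ind by (intro integral_cong_AE ae) (auto intro!: borel_measurable_sum borel_measurable_scaleR)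
  also have "\<dots> = (\<Sum>g\<in>G. \<integral>x. indicator {g} x *\<^sub>R f g \<partial>?p)"
    using G(2) by (intro Bochner_Integration.integral_sum integrable_scaleR_left)
      (auto simp: atom)
  also have "\<dots> = (\<Sum>g\<in>G. max 0 (\<nu> {g}) * f g)"
  proof (intro sum.cong refl)
    fix g assume g: "g \<in> G"
    have "measure ?p {g} = max 0 (\<nu> {g})"
      by (cases "0 \<le> \<nu> {g}") (simp_all add: measure_def atom[OF g] ennreal_neg)
    moreover have "{g} \<inter> space ?p = {g}" using sets.sets_into_space[OF G(2)[OF g]] by auto
    ultimately show "(\<integral>x. indicator {g} x *\<^sub>R f g \<partial>?p) = max 0 (\<nu> {g}) * f g"
      using G(2)[OF g] by (subst integral_scaleR_left) (auto simp: atom[OF g])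
  qed
  finally show ?thesis .
qed

lemma signed_integral_finite_support:
  assumes \<nu>: "signed_measure X \<nu>" and G: "finite G" "\<And>g. g \<in> G \<Longrightarrow> {g} \<in> sets X"
    and null: "\<And>A. A \<in> sets X \<Longrightarrow> A \<inter> G = {} \<Longrightarrow> \<nu> A = 0"
    and f: "f \<in> borel_measurable X"
  shows "signed_integral X \<nu> f = (\<Sum>g\<in>G. \<nu> {g} * f g)"
proof -
  have "(\<integral>x. f x \<partial>(positive_variation X \<nu>)) = (\<Sum>g\<in>G. max 0 (\<nu> {g}) * f g)"
    by (rule integral_positive_variation_finite_support[OF assms])
  moreover have "(\<integral>x. f x \<partial>(positive_variation X (\<lambda>A. - \<nu> A))) = (\<Sum>g\<in>G. max 0 (- \<nu> {g}) * f g)"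
    by (rule integral_positive_variation_finite_support[OF signed_measure_uminus[OF \<nu>] G _ f])
      (simp_all add: null)
  ultimately have "signed_integral X \<nu> f =
      (\<Sum>g\<in>G. max 0 (\<nu> {g}) * f g) - (\<Sum>g\<in>G. max 0 (- \<nu> {g}) * f g)"
    by (simp only: signed_integral_def)
  also have "\<dots> = (\<Sum>g\<in>G. \<nu> {g} * f g)"
    unfolding sum_subtractf[symmetric] by (intro sum.cong) (auto simp: max_def)
  finally show ?thesis .
qed

section \<open>Small variation implies exponential stability\<close>

lemma abs_le_sup_norm:
  assumes "continuous_on {-1..0} y" "\<theta> \<in> {-1..0}"
  shows "\<bar>y \<theta>\<bar> \<le> sup_norm y"
proof -
  have "compact ((\<lambda>\<theta>. \<bar>y \<theta>\<bar>) ` {-1..0})"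
    using assms(1) by (intro compact_continuous_image continuous_intros) auto
  then have "bdd_above ((\<lambda>\<theta>. \<bar>y \<theta>\<bar>) ` {-1..0})"
    by (intro bounded_imp_bdd_above compact_imp_bounded)
  then show ?thesis
    unfolding sup_norm_def by (intro cSUP_upper assms(2))
qed

lemma sup_norm_le:
  assumes "\<And>\<theta>. \<theta> \<in> {-1..0} \<Longrightarrow> \<bar>y \<theta>\<bar> \<le> C"
  shows "sup_norm y \<le> C"
  unfolding sup_norm_def using assms by (intro cSUP_least) auto

lemma exponentially_stable_if_small_variation:
  assumes \<nu>: "signed_measure delay_space \<nu>" and c: "0 \<le> c" "c < 1"
    and le: "\<And>A B. A \<in> sets delay_space \<Longrightarrow> B \<in> sets delay_space \<Longrightarrow>
      ennreal (\<nu> A - \<nu> B) \<le> ennreal c"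
  shows "exponentially_stable \<nu>"
proof -
  \<comment> \<open>This choice gives \<open>c * exp \<alpha> = 2 * c / (1 + c)\<close>, which is
    below 1 since \<open>c < 1\<close>.\<close>
  define \<alpha> where "\<alpha> = ln (2 / (1 + c))"
  have \<alpha>: "\<alpha> > 0" and exp: "exp \<alpha> = 2 / (1 + c)"
    using c by (simp_all add: \<alpha>_def)
  have small: "c * exp \<alpha> < 1"
    using c by (simp add: exp field_simps)
  have "sup_norm (\<lambda>\<theta>. x (t + \<theta>)) \<le> exp \<alpha> * exp (- \<alpha> * t) * sup_norm x"
    if sol: "is_solution \<nu> x" and t: "t \<ge> 0" for x t
  proof -
    have cont: "continuous_on {-1..} x"
      and eq: "\<And>t. t \<ge> 0 \<Longrightarrow> x t = signed_integral delay_space \<nu> (\<lambda>\<theta>. x (t + \<theta>))"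
      using sol by (auto simp: is_solution_def)
    have cont0: "continuous_on {-1..0} x"
      using cont by (rule continuous_on_subset) auto
    have N: "0 \<le> sup_norm x"
      using abs_le_sup_norm[OF cont0, of 0] by simp
    have decay: "exp (\<alpha> * T) * \<bar>x T\<bar> \<le> sup_norm x" if T: "T \<ge> -1" for T
    proof -
      define g where "g s = exp (\<alpha> * s) * \<bar>x s\<bar>" for s
      have "continuous_on {-1..T} g"
        unfolding g_def
        by (intro continuous_intros continuous_on_subset[OF cont]) auto
      then obtain s where s: "s \<in> {-1..T}" and max: "\<And>r. r \<in> {-1..T} \<Longrightarrow> g r \<le> g s"
        using continuous_attains_sup[of "{-1..T}" g] T by auto
      show ?thesis
      proof (cases "s \<ge> 0")
        case True
        \<comment> \<open>Maximality of \<open>g\<close> at \<open>s\<close> gives the factor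
          \<open>exp (- \<alpha> * \<theta>)\<close>, at most \<open>exp \<alpha>\<close> on the
          delay interval. The equation at time \<open>s\<close> then yields
          \<open>\<bar>x s\<bar> \<le> c * exp \<alpha> * \<bar>x s\<bar>\<close>, so
          \<open>x s = 0\<close>.\<close>
        have bound: "\<bar>x (s + \<theta>)\<bar> \<le> exp \<alpha> * \<bar>x s\<bar>" if \<theta>: "\<theta> \<in> {-1..0}" for \<theta>
        proof -
          have "exp (\<alpha> * (s + \<theta>)) * \<bar>x (s + \<theta>)\<bar> \<le> exp (\<alpha> * s) * \<bar>x s\<bar>"
            using max[of "s + \<theta>"] s True \<theta> by (simp add: g_def)
          then have "exp (\<alpha> * s) * (exp (\<alpha> * \<theta>) * \<bar>x (s + \<theta>)\<bar>) \<le> exp (\<alpha> * s) * \<bar>x s\<bar>"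
            by (simp add: distrib_left exp_add mult.assoc)
          then have "exp (\<alpha> * \<theta>) * \<bar>x (s + \<theta>)\<bar> \<le> \<bar>x s\<bar>" by simp
          moreover have "exp (- \<alpha>) * \<bar>x (s + \<theta>)\<bar> \<le> exp (\<alpha> * \<theta>) * \<bar>x (s + \<theta>)\<bar>"
            using \<theta> \<alpha> mult_left_mono[of "-1" \<theta> \<alpha>] by (intro mult_right_mono) auto
          ultimately have "exp (- \<alpha>) * \<bar>x (s + \<theta>)\<bar> \<le> \<bar>x s\<bar>" by simp
          then show ?thesis by (simp add: exp_minus divide_simps mult.commute)
        qed
        have "\<bar>x s\<bar> \<le> c * (exp \<alpha> * \<bar>x s\<bar>)"
          unfolding eq[OF True]
          by (rule abs_signed_integral_le[OF \<nu> c(1) _ le])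
            (use bound eq[OF True] in \<open>auto simp: space_restrict_space\<close>)
        then have "(1 - c * exp \<alpha>) * \<bar>x s\<bar> \<le> 0" by (simp add: algebra_simps)
        then have "x s = 0" using small by (simp add: mult_le_0_iff)
        then have "g T \<le> 0" using max[of T] T by (simp add: g_def)
        then show ?thesis using N by (simp add: g_def)
      next
        \<comment> \<open>Here the maximum lies in the initial segment, where the weight is at most
          1.\<close>
        case False
        have "g T \<le> g s" using max[of T] T by simp
        also have "g s \<le> 1 * \<bar>x s\<bar>"
          unfolding g_def using False \<alpha> by (intro mult_right_mono) (auto simp: mult_le_0_iff)
        also have "\<dots> \<le> sup_norm x"
          using abs_le_sup_norm[OF cont0, of s] s False by simp
        finally show ?thesis by (simp add: g_def)
      qed
    qed
    \<comment> \<open>Passing from values at \<open>t + \<theta>\<close> to the norm at time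
      \<open>t\<close> costs at most \<open>exp \<alpha>\<close>, which is the constant
      \<open>K\<close>.\<close>
    show ?thesis
    proof (rule sup_norm_le)
      fix \<theta> :: real assume \<theta>: "\<theta> \<in> {-1..0}"
      have "exp (\<alpha> * (t + \<theta>)) * \<bar>x (t + \<theta>)\<bar> \<le> sup_norm x"
        using decay[of "t + \<theta>"] t \<theta> by simp
      then have "\<bar>x (t + \<theta>)\<bar> \<le> exp (- (\<alpha> * (t + \<theta>))) * sup_norm x"
        unfolding exp_minus by (simp add: divide_simps mult.commute)
      also have "\<dots> \<le> exp (\<alpha> + - \<alpha> * t) * sup_norm x"
        using \<theta> \<alpha> mult_left_mono[of "-1" \<theta> \<alpha>] N
        by (intro mult_right_mono) (auto simp: algebra_simps)
      finally show "\<bar>x (t + \<theta>)\<bar> \<le> exp \<alpha> * exp (- \<alpha> * t) * sup_norm x"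
        unfolding exp_add .
    qed
  qed
  then show ?thesis
    unfolding exponentially_stable_def using \<alpha> by (intro exI[of _ \<alpha>] exI[of _ "exp \<alpha>"] conjI) auto
qed

section \<open>Arbitrarily small destabilizing perturbations\<close>

text \<open>Intermediate value theorem: the sum is at least 1 at 0 and tends to 0 at infinity
  because all delays are positive.\<close>

lemma ex_exponential_sum_eq_one:
  fixes a :: "'i \<Rightarrow> real"
  assumes "\<And>i. i \<in> I \<Longrightarrow> \<tau> i > 0" "1 \<le> (\<Sum>i\<in>I. a i)"
  obtains \<sigma> where "\<sigma> \<ge> 0" "(\<Sum>i\<in>I. a i * exp (- \<sigma> * \<tau> i)) = 1"
proof -
  define F where "F \<sigma> = (\<Sum>i\<in>I. a i * exp (- \<sigma> * \<tau> i))" for \<sigma>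
  have "(F \<longlongrightarrow> (\<Sum>i\<in>I. a i * 0)) at_top"
    unfolding F_def
  proof (intro tendsto_sum tendsto_mult tendsto_const)
    fix i assume "i \<in> I"
    then have "filterlim (\<lambda>\<sigma>. - \<sigma> * \<tau> i) at_bot at_top"
      using assms(1) by (auto simp: filterlim_uminus_at_bot
          intro!: filterlim_at_top_mult_tendsto_pos[OF tendsto_const] filterlim_ident)
    then show "((\<lambda>\<sigma>. exp (- \<sigma> * \<tau> i)) \<longlongrightarrow> 0) at_top"
      by (rule filterlim_compose[OF exp_at_bot])
  qed
  then have "eventually (\<lambda>\<sigma>. F \<sigma> < 1) at_top"
    by (simp add: order_tendstoD)
  then obtain b where b: "\<And>\<sigma>. \<sigma> \<ge> b \<Longrightarrow> F \<sigma> < 1"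
    by (auto simp: eventually_at_top_linorder)
  have "\<exists>\<sigma>. 0 \<le> \<sigma> \<and> \<sigma> \<le> max 0 b \<and> F \<sigma> = 1"
  proof (rule IVT2')
    show "F (max 0 b) \<le> 1" using b[of "max 0 b"] by simp
    show "1 \<le> F 0" using assms(2) by (simp add: F_def)
    show "continuous_on {0..max 0 b} F" unfolding F_def by (intro continuous_intros)
  qed simp
  then show ?thesis using that by (auto simp: F_def)
qed

lemma cos_minus_nat_pi: "cos (x - real m * pi) = (-1) ^ m * cos x"
  using cos_diff[of x "real m * pi"] by simp

text \<open>A cosine of period \<open>1 / n\<close> changes sign over each half period
  \<open>1 / (2 * n)\<close>. Its shifts to the atoms therefore produce the factors
  \<open>(-1) ^ m\<close>, and the alternating sum decides whether an exponential times this cosine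
  solves the equation.\<close>

lemma not_exponentially_stable_if_alternating_atoms:
  assumes \<nu>: "signed_measure delay_space \<nu>" and n: "n > 0"
    and null: "\<And>A. A \<in> sets delay_space \<Longrightarrow>
      A \<inter> (\<lambda>m. - (real m / real (2 * n))) ` {1..2 * n} = {} \<Longrightarrow> \<nu> A = 0"
    and ge: "1 \<le> (\<Sum>m\<in>{1..2 * n}. (-1) ^ m * \<nu> {- (real m / real (2 * n))})"
  shows "\<not> exponentially_stable \<nu>"
proof
  assume "exponentially_stable \<nu>"
  then obtain \<alpha> K where "\<alpha> > 0" "K > 0" and stable: "\<And>x t. is_solution \<nu> x \<Longrightarrow> t \<ge> 0 \<Longrightarrow>
      sup_norm (\<lambda>\<theta>. x (t + \<theta>)) \<le> K * exp (- \<alpha> * t) * sup_norm x"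
    unfolding exponentially_stable_def by blast
  define \<tau> where "\<tau> m = real m / real (2 * n)" for m
  have inj: "inj_on (\<lambda>m. - \<tau> m) {1..2 * n}"
    using n by (auto simp: \<tau>_def inj_on_def field_simps)
  obtain \<sigma> where \<sigma>: "\<sigma> \<ge> 0" "(\<Sum>m\<in>{1..2 * n}. ((-1) ^ m * \<nu> {- \<tau> m}) * exp (- \<sigma> * \<tau> m)) = 1"
    using ex_exponential_sum_eq_one[of "{1..2 * n}" \<tau> "\<lambda>m. (-1) ^ m * \<nu> {- \<tau> m}"] n ge
    unfolding \<tau>_def by auto
  define x where "x t = exp (\<sigma> * t) * cos (2 * pi * real n * t)" for t
  have cont: "continuous_on S (\<lambda>\<theta>. x (t + \<theta>))" for S t
    unfolding x_def by (intro continuous_intros)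
  have shift: "x (t - \<tau> m) = (-1) ^ m * exp (- \<sigma> * \<tau> m) * x t" for t m
  proof -
    have arg: "2 * pi * real n * (t - \<tau> m) = 2 * pi * real n * t - real m * pi"
      using n by (simp add: \<tau>_def field_simps)
    have exponent: "\<sigma> * (t - \<tau> m) = \<sigma> * t + - \<sigma> * \<tau> m" by (simp add: right_diff_distrib)
    show ?thesis
      unfolding x_def arg exponent cos_minus_nat_pi exp_add by (simp only: mult_ac)
  qed
  have "is_solution \<nu> x"
    unfolding is_solution_def
  proof (intro conjI allI impI)
    show "continuous_on {-1..} x" using cont[of _ 0] by simp
    fix t :: real
    have "signed_integral delay_space \<nu> (\<lambda>\<theta>. x (t + \<theta>)) =
        (\<Sum>g\<in>(\<lambda>m. - \<tau> m) ` {1..2 * n}. \<nu> {g} * x (t + g))"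
    proof (rule signed_integral_finite_support[OF \<nu>])
      show "{g} \<in> sets delay_space" if "g \<in> (\<lambda>m. - \<tau> m) ` {1..2 * n}" for g
        using that n by (auto simp: sets_restrict_space_iff \<tau>_def field_simps)
    qed (use null cont in \<open>auto simp: \<tau>_def intro!: borel_measurable_continuous_on_restrict\<close>)
    also have "\<dots> = (\<Sum>m\<in>{1..2 * n}. \<nu> {- \<tau> m} * x (t - \<tau> m))"
      unfolding sum.reindex[OF inj] o_def by simp
    also have "\<dots> = (\<Sum>m\<in>{1..2 * n}. ((-1) ^ m * \<nu> {- \<tau> m}) * exp (- \<sigma> * \<tau> m)) * x t"
      unfolding sum_distrib_right by (intro sum.cong refl) (simp add: shift)
    finally show "x t = signed_integral delay_space \<nu> (\<lambda>\<theta>. x (t + \<theta>))"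
      using \<sigma> by simp
  qed
  note stable = stable[OF this]
  \<comment> \<open>At integer times the cosine is 1 and the exponential at least 1, whereas the
    stability estimate tends to 0.\<close>
  have "1 \<le> K * sup_norm x * exp (- \<alpha> * real k)" for k :: nat
  proof -
    have "cos (2 * pi * real n * real k) = 1"
      using cos_int_2pin[of "int (n * k)"] by (simp add: mult_ac)
    then have "1 \<le> \<bar>x (real k)\<bar>"
      using \<sigma>(1) by (simp add: x_def)
    also have "\<dots> \<le> sup_norm (\<lambda>\<theta>. x (real k + \<theta>))"
      using abs_le_sup_norm[OF cont, of 0 "real k"] by simp
    also have "\<dots> \<le> K * sup_norm x * exp (- \<alpha> * real k)"
      using stable[of "real k"] by (simp add: mult_ac)
    finally show ?thesis .
  qed
  moreover have "(\<lambda>k. K * sup_norm x * exp (- \<alpha> * real k)) \<longlonglongrightarrow> K * sup_norm x * 0"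
  proof (intro tendsto_mult tendsto_const)
    have "filterlim (\<lambda>k. - \<alpha> * real k) at_bot sequentially"
      using \<open>\<alpha> > 0\<close> by (auto simp: filterlim_uminus_at_bot
          intro!: filterlim_tendsto_pos_mult_at_top[OF tendsto_const] filterlim_real_sequentially)
    then show "(\<lambda>k. exp (- \<alpha> * real k)) \<longlonglongrightarrow> 0"
      by (rule filterlim_compose[OF exp_at_bot])
  qed
  ultimately have "(1::real) \<le> K * sup_norm x * 0"
    by (intro LIMSEQ_le_const) auto
  then show False by simp
qed

lemma not_locally_strongly_stable:
  assumes \<mu>: "signed_measure delay_space \<mu>"
    and Y: "Y \<in> sets delay_space" and ge: "1 \<le> \<mu> Y - \<mu> ({-1..0} - Y)"
  shows "\<not> locally_strongly_stable \<mu>"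
proof
  assume "locally_strongly_stable \<mu>"
  then obtain \<epsilon> where "\<epsilon> > 0" and stable: "\<And>\<phi>. \<phi> \<in> delay_perturbations \<Longrightarrow>
      sup_norm (\<lambda>\<theta>. \<phi> \<theta> - \<theta>) < \<epsilon> \<Longrightarrow> measure_in_W (pushforward \<phi> \<mu>) \<Longrightarrow>
      exponentially_stable (pushforward \<phi> \<mu>)"
    unfolding locally_strongly_stable_def by blast
  obtain n :: nat where n: "n > 0" and small: "1 / real n < \<epsilon>"
    using \<open>\<epsilon> > 0\<close> by (metis nat_approx_posE zero_less_Suc)
  \<comment> \<open>Cells of length \<open>1 / n\<close> are numbered leftwards from 0: cell
    \<open>k\<close> runs from \<open>- k / n\<close> (included) to \<open>- (k - 1) / n\<close>
    (excluded). The \<open>max\<close> puts the point 0 into cell 1.\<close>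
  define k where "k \<theta> = max 1 (nat \<lceil>- \<theta> * real n\<rceil>)" for \<theta>
  \<comment> \<open>Points of \<open>Y\<close> go to the left end of their cell, the others to its
    midpoint. The parity of \<open>m \<theta>\<close> thus records membership in \<open>Y\<close>,
    and \<open>m \<theta> \<ge> 1\<close> keeps \<open>\<phi>\<close> away from 0.\<close>
  define m where "m \<theta> = 2 * k \<theta> - (if \<theta> \<in> Y then 0 else 1)" for \<theta>
  define \<phi> where "\<phi> \<theta> = - (real (m \<theta>) / real (2 * n))" for \<theta>
  have k: "1 \<le> k \<theta>" "k \<theta> \<le> n"
    "real (k \<theta>) - 1 \<le> - \<theta> * real n" "- \<theta> * real n \<le> real (k \<theta>)" if \<theta>: "\<theta> \<in> {-1..0}" for \<theta>
  proof -
    have "0 \<le> - \<theta> * real n" "- \<theta> * real n \<le> real n"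
      using \<theta> n mult_right_mono[of "- \<theta>" 1 "real n"] by (auto simp: mult_nonpos_nonneg)
    then show "1 \<le> k \<theta>" "k \<theta> \<le> n" "real (k \<theta>) - 1 \<le> - \<theta> * real n" "- \<theta> * real n \<le> real (k \<theta>)"
      unfolding k_def using n by (auto simp: max_def) linarith+
  qed
  have m: "m \<theta> \<in> {1..2 * n}" "even (m \<theta>) \<longleftrightarrow> \<theta> \<in> Y" if "\<theta> \<in> {-1..0}" for \<theta>
    using k(1,2)[OF that] by (auto simp: m_def)
  have \<phi>_range: "\<phi> \<theta> \<in> {-1..<0}" if "\<theta> \<in> {-1..0}" for \<theta>
    using m(1)[OF that] n by (auto simp: \<phi>_def)
  have [measurable]: "(\<lambda>\<theta>. \<theta>) \<in> borel_measurable delay_space"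
    by (rule measurable_restrict_space1) simp
  note [measurable] = Y
  \<comment> \<open>With a discrete target, any function of \<open>m\<close> is measurable, and so
    are the fibres of \<open>m\<close> used as \<open>C j\<close> below.\<close>
  have m_measurable: "m \<in> measurable delay_space (count_space UNIV)"
    unfolding m_def k_def by measurable
  then have "\<phi> \<in> borel_measurable delay_space"
    unfolding \<phi>_def
    using measurable_compose[OF m_measurable, of "\<lambda>j. - (real j / real (2 * n))" borel] by simp
  then have \<phi>: "\<phi> \<in> delay_perturbations"
    unfolding delay_perturbations_def using \<phi>_range
    by (intro measurable_restrict_space2) (force simp: space_restrict_space)+
  \<comment> \<open>Both \<open>\<theta>\<close> and \<open>\<phi> \<theta>\<close> lie in the same
    closed cell of length \<open>1 / n\<close>.\<close>
  have "sup_norm (\<lambda>\<theta>. \<phi> \<theta> - \<theta>) \<le> 1 / real n"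
  proof (rule sup_norm_le)
    fix \<theta> :: real assume \<theta>: "\<theta> \<in> {-1..0}"
    have "2 * real (k \<theta>) - 1 \<le> real (m \<theta>)" "real (m \<theta>) \<le> 2 * real (k \<theta>)"
      using k(1)[OF \<theta>] by (auto simp: m_def)
    then have "\<bar>real (m \<theta>) + \<theta> * real (2 * n)\<bar> \<le> 2"
      using k(3,4)[OF \<theta>] by auto
    then have "\<bar>real (m \<theta>) + \<theta> * real (2 * n)\<bar> / real (2 * n) \<le> 2 / real (2 * n)"
      by (rule divide_right_mono) simp
    moreover have "\<phi> \<theta> - \<theta> = - ((real (m \<theta>) + \<theta> * real (2 * n)) / real (2 * n))"
      using n by (simp add: \<phi>_def field_simps)
    ultimately show "\<bar>\<phi> \<theta> - \<theta>\<bar> \<le> 1 / real n"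
      using n by simp
  qed
  with small have close: "sup_norm (\<lambda>\<theta>. \<phi> \<theta> - \<theta>) < \<epsilon>" by simp
  define \<nu> where "\<nu> = pushforward \<phi> \<mu>"
  have \<nu>: "signed_measure delay_space \<nu>"
    unfolding \<nu>_def by (rule signed_measure_pushforward[OF \<mu> \<phi>])
  have null: "\<nu> A = 0" if "A \<inter> (\<lambda>m. - (real m / real (2 * n))) ` {1..2 * n} = {}" for A
  proof -
    have "\<phi> \<theta> \<in> (\<lambda>m. - (real m / real (2 * n))) ` {1..2 * n}" if "\<theta> \<in> {-1..0}" for \<theta>
      unfolding \<phi>_def by (intro imageI m(1) that)
    with that have "\<phi> -` A \<inter> {-1..0} = {}" by blast
    then show ?thesis by (simp add: \<nu>_def pushforward_def signed_measure_empty[OF \<mu>])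
  qed
  have "\<phi> -` {0} \<inter> {-1..0} = {}" using \<phi>_range by force
  then have "measure_in_W (pushforward \<phi> \<mu>)"
    by (simp add: measure_in_W_def pushforward_def signed_measure_empty[OF \<mu>])
  then have "exponentially_stable \<nu>"
    unfolding \<nu>_def by (rule stable[OF \<phi> close])
  moreover have "\<not> exponentially_stable \<nu>"
  proof (rule not_exponentially_stable_if_alternating_atoms[OF \<nu> n null])
    define C where "C j = m -` {j} \<inter> {-1..0}" for j
    have atom: "\<nu> {- (real j / real (2 * n))} = \<mu> (C j)" for j
      using n by (auto simp: \<nu>_def pushforward_def C_def \<phi>_def intro!: arg_cong[of _ _ \<mu>])
    have C: "C j \<in> sets delay_space" for j
      using measurable_sets[OF m_measurable, of "{j}"]
      by (simp add: C_def space_restrict_space)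
    have disj: "disjoint_family_on C J" for J
      by (auto simp: disjoint_family_on_def C_def)
    have Y01: "Y \<subseteq> {-1..0}"
      using sets.sets_into_space[OF Y] by (simp add: space_restrict_space)
    \<comment> \<open>The fibres of even index partition \<open>Y\<close> and those of odd index its
      complement, so the alternating sum of their measures is the difference in
      \<open>ge\<close>.\<close>
    have "Y = (\<Union>j\<in>{1..2 * n} \<inter> {j. even j}. C j)"
      using m Y01 by (auto simp: C_def)
    then have pos: "\<mu> Y = (\<Sum>j\<in>{1..2 * n} \<inter> {j. even j}. \<mu> (C j))"
      using signed_measure_finite_UN[OF \<mu> _ C disj, of "{1..2 * n} \<inter> {j. even j}"] by simp
    have "{-1..0} - Y = (\<Union>j\<in>{1..2 * n} \<inter> - {j. even j}. C j)"
      using m Y01 by (auto simp: C_def)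
    then have neg: "\<mu> ({-1..0} - Y) = (\<Sum>j\<in>{1..2 * n} \<inter> - {j. even j}. \<mu> (C j))"
      using signed_measure_finite_UN[OF \<mu> _ C disj, of "{1..2 * n} \<inter> - {j. even j}"] by simp
    have "(\<Sum>j\<in>{1..2 * n}. (-1) ^ j * \<mu> (C j)) = (\<Sum>j\<in>{1..2 * n}. if even j then \<mu> (C j) else - \<mu> (C j))"
      by (intro sum.cong) auto
    also have "\<dots> = \<mu> Y - \<mu> ({-1..0} - Y)"
      unfolding pos neg by (simp add: sum.If_cases sum_negf)
    finally show "1 \<le> (\<Sum>j\<in>{1..2 * n}. (-1) ^ j * \<nu> {- (real j / real (2 * n))})"
      using ge by (simp only: atom)
  qed
  ultimately show False by blast
qed

section \<open>Equivalence of small variation with local and global strong stability\<close>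

theorem theorem11:
  fixes M :: "real \<Rightarrow> real" and \<mu> :: "real set \<Rightarrow> real"
  assumes "bounded_variation_on (-1) 0 M"
    and "\<And>t. t \<in> {-1<..<0} \<Longrightarrow> continuous (at_right t) M"
    and "class_W M"
    and "associated_measure M \<mu>"
  shows "((\<integral>\<^sup>+\<xi>. 1 \<partial>(total_variation delay_space \<mu>)) < 1 \<longleftrightarrow> locally_strongly_stable \<mu>) \<and>
         (locally_strongly_stable \<mu> \<longleftrightarrow> strongly_stable \<mu>)"
proof -
  let ?tv = "emeasure (total_variation delay_space \<mu>) (space delay_space)"
  have \<mu>: "signed_measure delay_space \<mu>"
    using assms(4) by (simp add: associated_measure_def)
  have tv: "(\<integral>\<^sup>+\<xi>. 1 \<partial>(total_variation delay_space \<mu>)) = ?tv"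
    by simp
  \<comment> \<open>The implications form a cycle: small variation, strong stability, local strong
    stability, small variation.\<close>
  have "strongly_stable \<mu>" if "?tv < 1"
    unfolding strongly_stable_def
  proof (intro ballI impI)
    fix \<phi> assume \<phi>: "\<phi> \<in> delay_perturbations"
    \<comment> \<open>A total variation below 1 is finite, so its real value can serve as the
      constant \<open>c\<close> for every push-forward.\<close>
    have fin: "ennreal (enn2real ?tv) = ?tv"
      using that by (intro ennreal_enn2real) (auto simp: less_top[symmetric])
    show "exponentially_stable (pushforward \<phi> \<mu>)"
    proof (rule exponentially_stable_if_small_variation)
      show "signed_measure delay_space (pushforward \<phi> \<mu>)"
        by (rule signed_measure_pushforward[OF \<mu> \<phi>])
      show "enn2real ?tv < 1"
        using that fin by (metis ennreal_1 ennreal_less_iff enn2real_nonneg)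
      fix A B assume "A \<in> sets delay_space" "B \<in> sets delay_space"
      then have "\<phi> -` A \<inter> {-1..0} \<in> sets delay_space" "\<phi> -` B \<inter> {-1..0} \<in> sets delay_space"
        using \<phi> measurable_sets[of \<phi> delay_space delay_space]
        by (auto simp: delay_perturbations_def space_restrict_space)
      then show "ennreal (pushforward \<phi> \<mu> A - pushforward \<phi> \<mu> B) \<le> ennreal (enn2real ?tv)"
        unfolding fin pushforward_def by (rule diff_le_total_variation[OF \<mu>])
    qed simp
  qed
  moreover have "locally_strongly_stable \<mu>" if "strongly_stable \<mu>"
    using that unfolding strongly_stable_def locally_strongly_stable_def
    by (intro exI[of _ 1]) auto
  moreover have "?tv < 1" if "locally_strongly_stable \<mu>"
  proof (rule ccontr)
    assume "\<not> ?tv < 1"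
    then obtain Y where "Y \<in> sets delay_space" "1 \<le> \<mu> Y - \<mu> (space delay_space - Y)"
      using total_variation_ge_oneE[OF \<mu>] by (metis not_le)
    then show False
      using not_locally_strongly_stable[OF \<mu>] that by (simp add: space_restrict_space)
  qed
  ultimately show ?thesis unfolding tv by blast
qed

end
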